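(* Let $L\in\mathfrak{g}^J$, let $\alpha:I\to\mathbb{S}^J$ ($I$ an interval) be an integral curve of the Hamiltonian vector field $X_{\mathbf{J}^L}$ of $\mathbf{J}^L$ with respect to $\omega_{KB}$, and let $F(t)$ be a primitive of $\kappa(\alpha(t),L)$ on $I$. Then $\psi(t):=e^{\frac{i}{2}F(t)}\Psi(\alpha(t))$ satisfies the Schrödinger equation $$i\frac{d\psi}{dt}=H\psi,\qquad H:=\tfrac12\mathbf{Q}(L).$$
   Context: The Siegel-Jacobi space $\mathbb{S}^J$ is the complex manifold $\mathbb{H}\times\mathbb{C}$ ($\mathbb{H}$ the upper half-plane) with the Kähler metric $g_{KB}$ whose matrix in the coordinates $(u,v,x,y)$ ($\tau=u+iv\in\mathbb{H}$, $z=x+iy\in\mathbb{C}$) is $$\frac12\begin{bmatrix}\frac{v+y^2}{v^3}&0&-\frac{y}{v^2}&0\\0&\frac{v+y^2}{v^3}&0&-\frac{y}{v^2}\\-\frac{y}{v^2}&0&\frac1v&0\\0&-\frac{y}{v^2}&0&\frac1v\end{bmatrix},$$ and symplectic form $\omega_{KB}=g_{KB}(J\cdot,\cdot)$, $J$ being the complex structure. Hamiltonian vector fields satisfy $\omega_{KB}(X_f,\cdot)=df$. Coordinates $(\theta_1,\theta_2,\dot\theta_1,\dot\theta_2)$ on $\mathbb{S}^J$ ($\theta_2<0$) are defined by $\tau=\dot\theta_2-i\theta_2$, $z=-\dot\theta_1+i\theta_1$; $z_k=\theta_k+i\dot\theta_k$; $\eta_1=-\frac{\theta_1}{2\theta_2}$,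 $\eta_2=\frac{\theta_1^2-2\theta_2}{4\theta_2^2}$; $\psi(\theta)=-\frac{\theta_1^2}{4\theta_2}+\frac12\ln\big(-\frac{\pi}{\theta_2}\big)$. The map $\Psi:\mathbb{S}^J\to L^2(\mathbb{R})$ is $\Psi(p)(x)=\exp\{\frac12(z_1x+z_2x^2-\psi(\theta))\}$. $\mathfrak{g}^J=\mathfrak{sl}(2,\mathbb{R})\times\mathbb{R}^2\times\mathbb{R}$ is the Lie algebra of the Jacobi group, with basis $F=\big[\begin{smallmatrix}0&1\\0&0\end{smallmatrix}\big]$, $G=\big[\begin{smallmatrix}0&0\\1&0\end{smallmatrix}\big]$, $H=\big[\begin{smallmatrix}1&0\\0&-1\end{smallmatrix}\big]$ in $\mathfrak{sl}(2,\mathbb{R})$, $P=(1,0,0)$, $Q=(0,1,0)$, $R=(0,0,1)$ in $\mathbb{R}^2\times\mathbb{R}$ (the basis elements $F,H$ are not to be confused with the primitive $F(t)$ and the operator $H$ in the claim). The functions $\mathbf{J}^L$ are linear in $L$ with $\mathbf{J}^F=-\eta_2$, $\mathbf{J}^G=\frac14\dot\theta_1^2+\eta_2\dot\theta_2^2+\eta_1\dot\theta_1\dot\theta_2-\frac{1}{4(\eta_1^2-\eta_2)}$, $\mathbf{J}^H=-\eta_1\dot\theta_1-2\eta_2\dot\theta_2$, $\mathbf{J}^P=\frac12\dot\theta_1+\eta_1\dot\theta_2$, $\mathbf{J}^Q=\eta_1$, $\mathbf{J}^R=-\frac14$. $\mathbf{Q}:\mathfrak{g}^J\to\mathrm{End}(C^\infty(\mathbb{R},\mathbb{C}))$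 is the $\mathbb{R}$-linear map with $\mathbf{Q}(F)=-x^2$, $\mathbf{Q}(G)=-\frac{\partial^2}{\partial x^2}$, $\mathbf{Q}(H)=2i\big(x\frac{\partial}{\partial x}+\frac12I\big)$, $\mathbf{Q}(P)=-i\frac{\partial}{\partial x}$, $\mathbf{Q}(Q)=x$, $\mathbf{Q}(R)=-\frac14I$. $\kappa:\mathbb{S}^J\times\mathfrak{g}^J\to\mathbb{C}$ is the map, linear in the second entry, given at the point with coordinates $(\theta,\dot\theta)$ by $\kappa(\cdot,F)=0$, $\kappa(\cdot,Q)=0$, $\kappa(\cdot,R)=\frac14$, $\kappa(\cdot,P)=i\big(\frac{\theta_1+i\dot\theta_1}{2}+\theta_2\eta_1\big)$, $\kappa(\cdot,H)=-i(\eta_1\theta_1+2\eta_2\theta_2+1)$, $\kappa(\cdot,G)=i\eta_1(\dot\theta_1\theta_2+\theta_1\dot\theta_2)+2i\eta_2\theta_2\dot\theta_2-\frac14\dot\theta_1^2+\theta_2+i\dot\theta_2+\frac14\theta_1^2+\frac{i}{2}\theta_1\dot\theta_1$. *)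

theory Defs
  imports "HOL-Analysis.Analysis"
begin

section \<open>The Siegel-Jacobi space\<close>

text \<open>A point or a tangent vector is a pair \<open>(\<tau>, z)\<close> of complex numbers; since the
  Siegel-Jacobi space is open in \<open>\<complex>\<^sup>2\<close>, its tangent spaces are all identified with \<open>\<complex>\<^sup>2\<close>.\<close>

definition SJ :: "(complex \<times> complex) set" where
  "SJ = {(\<tau>, z). Im \<tau> > 0}"

definition coords :: "complex \<times> complex \<Rightarrow> real^4" where
  "coords p = vector [Re (fst p), Im (fst p), Re (snd p), Im (snd p)]"

definition gKB_matrix :: "complex \<times> complex \<Rightarrow> real^4^4" where
  "gKB_matrix p =
    (let v = Im (fst p); y = Im (snd p) in
      (1/2) *\<^sub>R vector
        [vector [(v + y\<^sup>2) / v^3, 0, - y / v\<^sup>2, 0],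
         vector [0, (v + y\<^sup>2) / v^3, 0, - y / v\<^sup>2],
         vector [- y / v\<^sup>2, 0, 1 / v, 0],
         vector [0, - y / v\<^sup>2, 0, 1 / v]])"

definition gKB :: "complex \<times> complex \<Rightarrow> complex \<times> complex \<Rightarrow> complex \<times> complex \<Rightarrow> real" where
  "gKB p X Y = coords X \<bullet> (gKB_matrix p *v coords Y)"

definition complex_structure :: "complex \<times> complex \<Rightarrow> complex \<times> complex" where
  "complex_structure X = (\<i> * fst X, \<i> * snd X)"

definition omegaKB :: "complex \<times> complex \<Rightarrow> complex \<times> complex \<Rightarrow> complex \<times> complex \<Rightarrow> real" where
  "omegaKB p X Y = gKB p (complex_structure X) Y"

text \<open>The vector field \<open>X\<^sub>f\<close> with \<open>\<omega>\<^sub>K\<^sub>B(X\<^sub>f, \<cdot>) = df\<close>; it is well defined wherever \<open>f\<close> is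
  differentiable, see \<open>hamiltonian_vf_ex1\<close> below.\<close>

definition hamiltonian_vf :: "(complex \<times> complex \<Rightarrow> real) \<Rightarrow> complex \<times> complex \<Rightarrow> complex \<times> complex" where
  "hamiltonian_vf f p = (THE X. (f has_derivative omegaKB p X) (at p))"

text \<open>At an endpoint of \<open>I\<close> that belongs to \<open>I\<close> the derivative is one-sided.\<close>

definition integral_curve_on ::
    "real set \<Rightarrow> 'a::real_normed_vector set \<Rightarrow> ('a \<Rightarrow> 'a) \<Rightarrow> (real \<Rightarrow> 'a) \<Rightarrow> bool" where
  "integral_curve_on I M X \<alpha> \<longleftrightarrow>
    (\<forall>t\<in>I. \<alpha> t \<in> M \<and> (\<alpha> has_vector_derivative X (\<alpha> t)) (at t within I))"

lemma vector_4 [simp]: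
  "(vector [a, b, c, d] :: 'a::zero^4) $ 1 = a"
  "(vector [a, b, c, d] :: 'a::zero^4) $ 2 = b"
  "(vector [a, b, c, d] :: 'a::zero^4) $ 3 = c"
  "(vector [a, b, c, d] :: 'a::zero^4) $ 4 = d"
  unfolding vector_def by simp_all

lemma omegaKB_explicit:
  assumes "A = (Im (fst p) + (Im (snd p))\<^sup>2) / (Im (fst p))^3"
    and "B = Im (snd p) / (Im (fst p))\<^sup>2" and "C = 1 / Im (fst p)"
  shows "omegaKB p X Y =
    ((B * Im (snd X) - A * Im (fst X)) * Re (fst Y)
     + (A * Re (fst X) - B * Re (snd X)) * Im (fst Y)
     + (B * Im (fst X) - C * Im (snd X)) * Re (snd Y)
     + (C * Re (snd X) - B * Re (fst X)) * Im (snd Y)) / 2"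
proof -
  have M: "gKB_matrix p = (1/2) *\<^sub>R vector
      [vector [A, 0, - B, 0], vector [0, A, 0, - B], vector [- B, 0, C, 0], vector [0, - B, 0, C]]"
    by (simp add: gKB_matrix_def Let_def assms)
  show ?thesis
    unfolding omegaKB_def gKB_def complex_structure_def coords_def M
    by (simp add: inner_vec_def matrix_vector_mult_def sum_4 algebra_simps)
qed

lemma hamiltonian_vf_ex1:
  assumes p: "p \<in> SJ" and f: "f differentiable (at p)"
  shows "\<exists>!X. (f has_derivative omegaKB p X) (at p)"
proof -
  define v where "v = Im (fst p)"
  define y where "y = Im (snd p)"
  define A where "A = (v + y\<^sup>2) / v^3"
  define B where "B = y / v\<^sup>2"
  define C where "C = 1 / v"
  have v: "v > 0" using p by (auto simp: SJ_def v_def)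
  note omega = omegaKB_explicit[of A p B C,
      OF A_def[unfolded v_def y_def] B_def[unfolded v_def y_def] C_def[unfolded v_def]]
  have det: "v^3 * (A * C - B * B) = 1"
    using v by (simp add: A_def B_def C_def field_simps power2_eq_square power3_eq_cube)
  obtain f' where f': "(f has_derivative f') (at p)"
    using f by (auto simp: differentiable_def)
  interpret f': bounded_linear f' by (rule has_derivative_bounded_linear[OF f'])
  define a b c d where "a = f' (1, 0)" and "b = f' (\<i>, 0)" and "c = f' (0, 1)" and "d = f' (0, \<i>)"
  have f'_eq: "f' Y = a * Re (fst Y) + b * Im (fst Y) + c * Re (snd Y) + d * Im (snd Y)" for Y
  proof -
    have "Y = Re (fst Y) *\<^sub>R (1, 0) + Im (fst Y) *\<^sub>R (\<i>, 0) + Re (snd Y) *\<^sub>R (0, 1) + Im (snd Y) *\<^sub>R (0, \<i>)"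
      by (simp add: prod_eq_iff complex_eq_iff)
    then have "f' Y = f' (Re (fst Y) *\<^sub>R (1, 0) + Im (fst Y) *\<^sub>R (\<i>, 0) + Re (snd Y) *\<^sub>R (0, 1) + Im (snd Y) *\<^sub>R (0, \<i>))"
      by simp
    also have "\<dots> = a * Re (fst Y) + b * Im (fst Y) + c * Re (snd Y) + d * Im (snd Y)"
      by (simp only: f'.add f'.scaleR a_def b_def c_def d_def real_scaleR_def mult.commute)
    finally show ?thesis .
  qed
  define X where
    "X = (Complex (2 * v^3 * (C * b + B * d)) (- 2 * v^3 * (C * a + B * c)),
          Complex (2 * v^3 * (B * b + A * d)) (- 2 * v^3 * (B * a + A * c)))"
  have "omegaKB p X Y = v^3 * (A * C - B * B) * f' Y" for Y
    by (simp add: omega f'_eq X_def field_simps)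
  then have "omegaKB p X = f'" by (simp add: det fun_eq_iff)
  moreover have "Z = W" if ZW: "omegaKB p Z = omegaKB p W" for Z W
  proof -
    have 1: "B * Im (snd Z) - A * Im (fst Z) = B * Im (snd W) - A * Im (fst W)"
      using fun_cong[OF ZW, of "(1, 0)"] by (simp add: omega)
    have 2: "A * Re (fst Z) - B * Re (snd Z) = A * Re (fst W) - B * Re (snd W)"
      using fun_cong[OF ZW, of "(\<i>, 0)"] by (simp add: omega)
    have 3: "B * Im (fst Z) - C * Im (snd Z) = B * Im (fst W) - C * Im (snd W)"
      using fun_cong[OF ZW, of "(0, 1)"] by (simp add: omega)
    have 4: "C * Re (snd Z) - B * Re (fst Z) = C * Re (snd W) - B * Re (fst W)"
      using fun_cong[OF ZW, of "(0, \<i>)"] by (simp add: omega)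
    have inj: "s = s' \<and> r = r'" if "A * s - B * r = A * s' - B * r'" "C * r - B * s = C * r' - B * s'"
      for s r s' r'
    proof -
      have "(A * C - B * B) * (s - s') = 0" "(A * C - B * B) * (r - r') = 0"
        using that by algebra+
      moreover have "A * C - B * B \<noteq> 0" using det by auto
      ultimately show ?thesis by simp
    qed
    from inj[of "Re (fst Z)" "Re (snd Z)" "Re (fst W)" "Re (snd W)"]
         inj[of "Im (fst Z)" "Im (snd Z)" "Im (fst W)" "Im (snd W)"] 1 2 3 4
    show "Z = W" by (simp add: prod_eq_iff complex_eq_iff)
  qed
  ultimately show ?thesis using f' by (metis has_derivative_unique)
qed

section \<open>The coordinates and the map \<open>\<Psi>\<close>\<close>

text \<open>The coordinates solve \<open>\<tau> = \<theta>\<^sub>2' - i \<theta>\<^sub>2\<close> and \<open>z = - \<theta>\<^sub>1' + i \<theta>\<^sub>1\<close>; the dotted coordinates are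
  called \<open>dtheta1\<close> and \<open>dtheta2\<close>.\<close>

definition theta1 :: "complex \<times> complex \<Rightarrow> real" where
  "theta1 p = Im (snd p)"

definition theta2 :: "complex \<times> complex \<Rightarrow> real" where
  "theta2 p = - Im (fst p)"

definition dtheta1 :: "complex \<times> complex \<Rightarrow> real" where
  "dtheta1 p = - Re (snd p)"

definition dtheta2 :: "complex \<times> complex \<Rightarrow> real" where
  "dtheta2 p = Re (fst p)"

lemma SJ_coordinates:
  "fst p = of_real (dtheta2 p) - \<i> * of_real (theta2 p)"
  "snd p = - of_real (dtheta1 p) + \<i> * of_real (theta1 p)"
  by (simp_all add: theta1_def theta2_def dtheta1_def dtheta2_def complex_eq_iff)

definition eta1 :: "complex \<times> complex \<Rightarrow> real" where
  "eta1 p = - theta1 p / (2 * theta2 p)"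

definition eta2 :: "complex \<times> complex \<Rightarrow> real" where
  "eta2 p = ((theta1 p)\<^sup>2 - 2 * theta2 p) / (4 * (theta2 p)\<^sup>2)"

definition z1 :: "complex \<times> complex \<Rightarrow> complex" where
  "z1 p = of_real (theta1 p) + \<i> * of_real (dtheta1 p)"

definition z2 :: "complex \<times> complex \<Rightarrow> complex" where
  "z2 p = of_real (theta2 p) + \<i> * of_real (dtheta2 p)"

definition log_partition :: "complex \<times> complex \<Rightarrow> real" where
  "log_partition p = - (theta1 p)\<^sup>2 / (4 * theta2 p) + 1/2 * ln (- pi / theta2 p)"

definition Psi :: "complex \<times> complex \<Rightarrow> real \<Rightarrow> complex" where
  "Psi p x = exp (1/2 * (z1 p * of_real x + z2 p * (of_real x)\<^sup>2 - of_real (log_partition p)))"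

section \<open>The Lie algebra of the Jacobi group\<close>

type_synonym jacobi = "(real^2^2) \<times> (real \<times> real \<times> real)"

definition gJ :: "jacobi set" where
  "gJ = {A. trace A = 0} \<times> UNIV"

definition gJ_F :: jacobi where "gJ_F = (vector [vector [0, 1], vector [0, 0]], (0, 0, 0))"
definition gJ_G :: jacobi where "gJ_G = (vector [vector [0, 0], vector [1, 0]], (0, 0, 0))"
definition gJ_H :: jacobi where "gJ_H = (vector [vector [1, 0], vector [0, -1]], (0, 0, 0))"
definition gJ_P :: jacobi where "gJ_P = (0, (1, 0, 0))"
definition gJ_Q :: jacobi where "gJ_Q = (0, (0, 1, 0))"
definition gJ_R :: jacobi where "gJ_R = (0, (0, 0, 1))"

text \<open>The linear extension to \<open>gJ\<close> of an assignment of values to the basis \<open>F, G, H, P, Q, R\<close>,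
  in this order; the values of \<open>gJ_extend\<close> outside \<open>gJ\<close> are irrelevant.\<close>

definition gJ_extend ::
    "'a::real_vector \<Rightarrow> 'a \<Rightarrow> 'a \<Rightarrow> 'a \<Rightarrow> 'a \<Rightarrow> 'a \<Rightarrow> jacobi \<Rightarrow> 'a" where
  "gJ_extend aF aG aH aP aQ aR L =
    (case L of (A, (p, q, r)) \<Rightarrow>
      A$1$2 *\<^sub>R aF + A$2$1 *\<^sub>R aG + A$1$1 *\<^sub>R aH + p *\<^sub>R aP + q *\<^sub>R aQ + r *\<^sub>R aR)"

lemma gJ_decomposition:
  assumes "L \<in> gJ"
  shows "L = gJ_extend gJ_F gJ_G gJ_H gJ_P gJ_Q gJ_R L"
  using assms
  by (auto simp: gJ_def gJ_extend_def gJ_F_def gJ_G_def gJ_H_def gJ_P_def gJ_Q_def gJ_R_def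
      trace_def sum_2 vec_eq_iff forall_2 zero_prod_def)

lemma gJ_extend_linear: "linear (gJ_extend aF aG aH aP aQ aR)"
  by (rule linearI) (auto simp: gJ_extend_def algebra_simps)

lemma gJ_extend_basis:
  "gJ_extend aF aG aH aP aQ aR gJ_F = aF"
  "gJ_extend aF aG aH aP aQ aR gJ_G = aG"
  "gJ_extend aF aG aH aP aQ aR gJ_H = aH"
  "gJ_extend aF aG aH aP aQ aR gJ_P = aP"
  "gJ_extend aF aG aH aP aQ aR gJ_Q = aQ"
  "gJ_extend aF aG aH aP aQ aR gJ_R = aR"
  by (simp_all add: gJ_extend_def gJ_F_def gJ_G_def gJ_H_def gJ_P_def gJ_Q_def gJ_R_def)

definition JJ :: "jacobi \<Rightarrow> complex \<times> complex \<Rightarrow> real" where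
  "JJ L p = gJ_extend
    (- eta2 p)
    (1/4 * (dtheta1 p)\<^sup>2 + eta2 p * (dtheta2 p)\<^sup>2 + eta1 p * dtheta1 p * dtheta2 p
      - 1 / (4 * ((eta1 p)\<^sup>2 - eta2 p)))
    (- eta1 p * dtheta1 p - 2 * eta2 p * dtheta2 p)
    (1/2 * dtheta1 p + eta1 p * dtheta2 p)
    (eta1 p)
    (- 1/4) L"

definition kappa :: "complex \<times> complex \<Rightarrow> jacobi \<Rightarrow> complex" where
  "kappa p L =
    (let t1 = complex_of_real (theta1 p); t2 = complex_of_real (theta2 p);
         d1 = complex_of_real (dtheta1 p); d2 = complex_of_real (dtheta2 p);
         e1 = complex_of_real (eta1 p); e2 = complex_of_real (eta2 p)
     in gJ_extend
      0
      (\<i> * e1 * (d1 * t2 + t1 * d2) + 2 * \<i> * e2 * t2 * d2 - 1/4 * d1\<^sup>2 + t2 + \<i> * d2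
        + 1/4 * t1\<^sup>2 + \<i> / 2 * t1 * d1)
      (- \<i> * (e1 * t1 + 2 * e2 * t2 + 1))
      (\<i> * ((t1 + \<i> * d1) / 2 + t2 * e1))
      0
      (1/4) L)"

section \<open>The operators \<open>Q(L)\<close> and the Schroedinger equation\<close>

definition Dx :: "(real \<Rightarrow> complex) \<Rightarrow> real \<Rightarrow> complex" where
  "Dx \<phi> x = vector_derivative \<phi> (at x)"

definition Cinf :: "(real \<Rightarrow> complex) set" where
  "Cinf = {\<phi>. \<forall>n x. (Dx ^^ n) \<phi> differentiable (at x)}"

definition QQ :: "jacobi \<Rightarrow> (real \<Rightarrow> complex) \<Rightarrow> real \<Rightarrow> complex" where
  "QQ L \<phi> x = gJ_extend
    (- (of_real x)\<^sup>2 * \<phi> x)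
    (- Dx (Dx \<phi>) x)
    (2 * \<i> * (of_real x * Dx \<phi> x + 1/2 * \<phi> x))
    (- \<i> * Dx \<phi> x)
    (of_real x * \<phi> x)
    (- 1/4 * \<phi> x) L"

text \<open>Functions are not identified almost everywhere: \<open>L2\<close> consists of representatives, and
  \<open>L2_norm\<close> is the seminorm on them (meaningful only on \<open>L2\<close>, where its integral converges).\<close>

definition L2 :: "(real \<Rightarrow> complex) set" where
  "L2 = {\<phi>. \<phi> \<in> borel_measurable lborel \<and> integrable lborel (\<lambda>x. (cmod (\<phi> x))\<^sup>2)}"

definition L2_norm :: "(real \<Rightarrow> complex) \<Rightarrow> real" where
  "L2_norm \<phi> = sqrt (LINT x|lborel. (cmod (\<phi> x))\<^sup>2)"

definition has_L2_derivative ::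
    "(real \<Rightarrow> real \<Rightarrow> complex) \<Rightarrow> (real \<Rightarrow> complex) \<Rightarrow> real \<Rightarrow> real set \<Rightarrow> bool" where
  "has_L2_derivative \<psi> D t I \<longleftrightarrow> D \<in> L2 \<and>
    ((\<lambda>s. L2_norm (\<lambda>x. (\<psi> s x - \<psi> t x) / of_real (s - t) - D x)) \<longlongrightarrow> 0) (at t within I)"

text \<open>A solution of \<open>i d\<psi>/dt = H \<psi>\<close> for a curve \<open>\<psi>\<close> in \<open>L\<^sup>2(\<real>)\<close> taking its values in the domain
  \<open>C\<^sup>\<infinity>(\<real>, \<complex>)\<close> of \<open>H\<close>. The derivative \<open>D = d\<psi>/dt\<close> is required to exist both as a limit in
  \<open>L\<^sup>2(\<real>)\<close> and pointwise in \<open>x\<close>; neither of these implies the other.\<close>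

definition schroedinger_solution ::
    "real set \<Rightarrow> ((real \<Rightarrow> complex) \<Rightarrow> real \<Rightarrow> complex) \<Rightarrow> (real \<Rightarrow> real \<Rightarrow> complex) \<Rightarrow> bool" where
  "schroedinger_solution I H \<psi> \<longleftrightarrow>
    (\<forall>t\<in>I. \<psi> t \<in> Cinf \<and> \<psi> t \<in> L2 \<and>
      (\<exists>D. has_L2_derivative \<psi> D t I \<and>
           (\<forall>x. ((\<lambda>s. \<psi> s x) has_vector_derivative D x) (at t within I)) \<and>
           (\<forall>x. \<i> * D x = H (\<psi> t) x)))"

end

theory Submission
  imports Defs "HOL-Probability.Distributions" "HOL-Computational_Algebra.Polynomial"
begin

text \<open>In the coordinates \<open>(\<tau>, z)\<close> the Hamiltonian field of \<open>JJ L\<close> is the quadratic field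
  \<open>\<tau>' = f + 2 h \<tau> - g \<tau>\<^sup>2\<close>, \<open>z' = q + p \<tau> + h z - g \<tau> z\<close>, where \<open>f, g, h, p, q\<close> are the coefficients of
  \<open>L\<close>. Moreover \<open>\<Psi>(\<tau>, z)(x) = exp (i \<tau> x\<^sup>2 / 2 - i z x / 2 - log_partition / 2)\<close>. Along an integral
  curve, the phase \<open>\<kappa>\<close> combines with the derivative of \<open>log_partition\<close> to a polynomial in \<open>\<tau>\<close> and
  \<open>z\<close>, so both sides of the Schroedinger equation are the same quadratic polynomial in \<open>x\<close> times a
  Gaussian. The derivative also exists in \<open>L\<^sup>2(\<real>)\<close> by dominated convergence: since \<open>Re (i \<tau>) < 0\<close>, the
  difference quotients near a given time are bounded by one fixed Gaussian.\<close>

section \<open>Linear extension from the basis of the Lie algebra\<close>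

lemma linear_gJ_extend:
  assumes "linear f"
  shows "f (gJ_extend aF aG aH aP aQ aR L) = gJ_extend (f aF) (f aG) (f aH) (f aP) (f aQ) (f aR) L"
  by (simp add: gJ_extend_def linear_add[OF assms] linear_scale[OF assms] split: prod.split)

lemma gJ_extend_add:
  "gJ_extend aF aG aH aP aQ aR L + gJ_extend bF bG bH bP bQ bR L =
    gJ_extend (aF + bF) (aG + bG) (aH + bH) (aP + bP) (aQ + bQ) (aR + bR) L"
  by (simp add: gJ_extend_def algebra_simps split: prod.split)

lemma gJ_extend_diff:
  "gJ_extend aF aG aH aP aQ aR L - gJ_extend bF bG bH bP bQ bR L =
    gJ_extend (aF - bF) (aG - bG) (aH - bH) (aP - bP) (aQ - bQ) (aR - bR) L"
  by (simp add: gJ_extend_def algebra_simps split: prod.split)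

lemma gJ_extend_of_real:
  "of_real (gJ_extend aF aG aH aP aQ aR L) = (gJ_extend (of_real aF) (of_real aG) (of_real aH)
    (of_real aP) (of_real aQ) (of_real aR) L :: complex)"
  by (rule linear_gJ_extend) (simp add: bounded_linear.linear bounded_linear_of_real)

lemma gJ_extend_mult_left:
  fixes k :: "'a::real_algebra"
  shows "k * gJ_extend aF aG aH aP aQ aR L =
    gJ_extend (k * aF) (k * aG) (k * aH) (k * aP) (k * aQ) (k * aR) L"
  by (rule linear_gJ_extend) (simp add: linear_iff algebra_simps)

lemma gJ_extend_mult_right:
  fixes k :: "'a::real_algebra"
  shows "gJ_extend aF aG aH aP aQ aR L * k =
    gJ_extend (aF * k) (aG * k) (aH * k) (aP * k) (aQ * k) (aR * k) L"
  by (rule linear_gJ_extend) (simp add: linear_iff algebra_simps)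

lemma gJ_extend_divide:
  fixes k :: "'a::real_normed_field"
  shows "gJ_extend aF aG aH aP aQ aR L / k =
    gJ_extend (aF / k) (aG / k) (aH / k) (aP / k) (aQ / k) (aR / k) L"
  by (simp add: divide_inverse gJ_extend_mult_right)

lemma gJ_extend_cong:
  "\<lbrakk>aF = bF; aG = bG; aH = bH; aP = bP; aQ = bQ; aR = bR\<rbrakk> \<Longrightarrow>
    gJ_extend aF aG aH aP aQ aR L = gJ_extend bF bG bH bP bQ bR L"
  by simp

text \<open>Rewriting with these collects each side of an equation into a single
  \<open>gJ_extend\<close> at \<open>L\<close>; \<open>gJ_extend_cong\<close> then leaves six
  identities, one per basis element.\<close>

lemmas gJ_extend_arith = gJ_extend_add gJ_extend_diff gJ_extend_of_real gJ_extend_mult_left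
  gJ_extend_mult_right gJ_extend_divide

section \<open>The Hamiltonian vector fields\<close>

text \<open>These are the infinitesimal generators of the action of the Jacobi group by Moebius maps
  on \<tau> and affine maps on \<open>z\<close>. The central element \<open>R\<close> acts
  trivially, in accordance with its constant Hamiltonian.\<close>

definition jacobi_field :: "jacobi \<Rightarrow> complex \<times> complex \<Rightarrow> complex \<times> complex" where
  "jacobi_field L p = gJ_extend (1, 0) (- (fst p)\<^sup>2, - fst p * snd p) (2 * fst p, snd p)
    (0, fst p) (0, 1) (0, 0) L"

lemma jacobi_field_components:
  "fst (jacobi_field L p) = gJ_extend 1 (- (fst p)\<^sup>2) (2 * fst p) 0 0 0 L"
  "snd (jacobi_field L p) = gJ_extend 0 (- fst p * snd p) (snd p) (fst p) 1 0 L"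
  unfolding jacobi_field_def
  by (subst linear_gJ_extend[of fst] linear_gJ_extend[of snd]; simp add: linear_iff)+

lemma eta1_has_derivative:
  assumes "p \<in> SJ"
  shows "(eta1 has_derivative (\<lambda>Y. Im (snd Y) / (2 * Im (fst p))
    - Im (snd p) * Im (fst Y) / (2 * (Im (fst p))\<^sup>2))) (at p)"
proof -
  have "Im (fst p) \<noteq> 0" using assms by (auto simp: SJ_def)
  then show ?thesis
    unfolding eta1_def[abs_def] theta1_def theta2_def
    by (auto intro!: derivative_eq_intros simp: field_simps power2_eq_square)
qed

lemma eta2_has_derivative:
  assumes "p \<in> SJ"
  shows "(eta2 has_derivative (\<lambda>Y. Im (snd p) * Im (snd Y) / (2 * (Im (fst p))\<^sup>2)
    - ((Im (snd p))\<^sup>2 + Im (fst p)) * Im (fst Y) / (2 * (Im (fst p))^3))) (at p)"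
proof -
  have "Im (fst p) \<noteq> 0" using assms by (auto simp: SJ_def)
  then show ?thesis
    unfolding eta2_def[abs_def] theta1_def theta2_def
    by (auto intro!: derivative_eq_intros simp: field_simps power2_eq_square power3_eq_cube)
qed

text \<open>For \<open>Im (fst p) = 0\<close> both sides vanish because \<open>x / 0 = 0\<close>.\<close>

lemma eta_discriminant: "1 / (4 * ((eta1 p)\<^sup>2 - eta2 p)) = - Im (fst p) / 2"
  by (cases "Im (fst p) = 0")
    (simp_all add: eta1_def eta2_def theta1_def theta2_def field_simps power2_eq_square)

lemma JJ_has_derivative:
  assumes "p \<in> SJ"
  shows "(JJ L has_derivative omegaKB p (jacobi_field L p)) (at p)"
proof -
  obtain A a b c where L: "L = (A, (a, b, c))" by (metis surj_pair)
  note eta = eta1_has_derivative[OF assms] eta2_has_derivative[OF assms]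
  define u where "u = Re (fst p)"
  define v where "v = Im (fst p)"
  define x where "x = Re (snd p)"
  define y where "y = Im (snd p)"
  \<comment> \<open>Once \<open>div\<close> replaces all quotients by powers of \<open>w\<close>,
    the claim is polynomial modulo the single relation \<open>v * w = 1\<close>, which
    \<open>algebra\<close> can settle.\<close>
  define w where "w = 1 / v"
  have w: "v * w = 1" using assms by (auto simp: SJ_def v_def w_def)
  have div: "s / v = s * w" "s / (2 * v) = s * w / 2" "s / v\<^sup>2 = s * w\<^sup>2"
    "s / (2 * v\<^sup>2) = s * w\<^sup>2 / 2" "s / (4 * v\<^sup>2) = s * w\<^sup>2 / 4"
    "s / v^3 = s * w^3" "s / (2 * v^3) = s * w^3 / 2" for s
    by (simp_all add: w_def power_divide)
  show ?thesis
    unfolding JJ_def[abs_def] gJ_extend_def L prod.case eta_discriminant dtheta1_def dtheta2_def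
  proof (rule has_derivative_eq_rhs, (rule derivative_eq_intros refl eta | simp)+, rule ext, goal_cases)
    case (1 Y)
    then show ?case
      by (simp add: omegaKB_explicit[OF refl refl refl] jacobi_field_def gJ_extend_def L
        eta1_def eta2_def theta1_def theta2_def u_def[symmetric] v_def[symmetric]
        x_def[symmetric] y_def[symmetric] Re_power2 Im_power2 div,
          use w in algebra)
  qed
qed

text \<open>The definite description in \<open>hamiltonian_vf\<close> is resolved by nondegeneracy
  of the form, through \<open>hamiltonian_vf_ex1\<close>, with \<open>jacobi_field\<close> as
  witness.\<close>

lemma hamiltonian_vf_JJ:
  assumes "p \<in> SJ"
  shows "hamiltonian_vf (JJ L) p = jacobi_field L p"
  unfolding hamiltonian_vf_def
proof (rule the1_equality)
  show "\<exists>!X. (JJ L has_derivative omegaKB p X) (at p)"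
    by (rule hamiltonian_vf_ex1[OF assms differentiableI[OF JJ_has_derivative[OF assms]]])
qed (rule JJ_has_derivative[OF assms])

section \<open>Differentiating Gaussians in \<open>L\<^sup>2\<close>\<close>

lemma integrable_exp_minus_square:
  fixes d :: real
  assumes "d > 0"
  shows "integrable lborel (\<lambda>x. exp (- d * x\<^sup>2))"
proof -
  \<comment> \<open>The centred normal density of variance \<open>1 / (2 * d)\<close> is
    \<open>sqrt (d / pi) * exp (- d * x\<^sup>2)\<close>.\<close>
  have "exp (- d * x\<^sup>2) = sqrt (pi / d) * normal_density 0 (1 / sqrt (2 * d)) x" for x
    using assms by (simp add: normal_density_def field_simps real_sqrt_divide)
  then show ?thesis using integrable_normal_density[of "1 / sqrt (2 * d)" 0] assms by simp
qed

text \<open>The linear terms are absorbed into \<open>-d x\<^sup>2\<close> by completing the square, the polynomial factor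
  by the series of \<open>exp \<bar>x\<bar>\<close>.\<close>

lemma quadratic_times_exp_le:
  fixes d K x :: real
  assumes "d > 0" "K \<ge> 0"
  shows "K * (x\<^sup>2 + \<bar>x\<bar> + 1) * exp (- d * x\<^sup>2 + K * \<bar>x\<bar> + K)
    \<le> 2 * K * exp (K + (K + 1)\<^sup>2 / (2 * d)) * exp (- (d / 2) * x\<^sup>2)"
proof -
  have "1 + \<bar>x\<bar> + \<bar>x\<bar>\<^sup>2 / 2 \<le> exp \<bar>x\<bar>" by (rule exp_lower_Taylor_quadratic) simp
  then have 1: "x\<^sup>2 + \<bar>x\<bar> + 1 \<le> 2 * exp \<bar>x\<bar>" by simp
  \<comment> \<open>Half of the decay is spent on the linear term; the 1 in \<open>K + 1\<close>
    accounts for the factor \<open>exp \<bar>x\<bar>\<close>.\<close>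
  have "0 \<le> (d * \<bar>x\<bar> - (K + 1))\<^sup>2 / (2 * d)" using assms by simp
  also have "\<dots> = d / 2 * x\<^sup>2 - (K + 1) * \<bar>x\<bar> + (K + 1)\<^sup>2 / (2 * d)"
    using assms by (simp add: field_simps power2_eq_square)
  finally have 2: "\<bar>x\<bar> + (- d * x\<^sup>2 + K * \<bar>x\<bar> + K) \<le> (K + (K + 1)\<^sup>2 / (2 * d)) + - (d / 2) * x\<^sup>2"
    by (simp add: algebra_simps)
  have "K * (x\<^sup>2 + \<bar>x\<bar> + 1) * exp (- d * x\<^sup>2 + K * \<bar>x\<bar> + K)
      \<le> K * (2 * exp \<bar>x\<bar>) * exp (- d * x\<^sup>2 + K * \<bar>x\<bar> + K)"
    using 1 assms by (intro mult_right_mono mult_left_mono) auto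
  also have "\<dots> = 2 * K * exp (\<bar>x\<bar> + (- d * x\<^sup>2 + K * \<bar>x\<bar> + K))" by (simp add: exp_add)
  also have "\<dots> \<le> 2 * K * exp ((K + (K + 1)\<^sup>2 / (2 * d)) + - (d / 2) * x\<^sup>2)"
    using 2 assms by (intro mult_left_mono) auto
  finally show ?thesis by (simp only: exp_add mult.assoc)
qed

lemma norm_quadratic_le:
  fixes p q r :: complex and x :: real
  assumes "norm p \<le> K" "norm q \<le> K" "norm r \<le> K"
  shows "norm (p * (of_real x)\<^sup>2 + q * of_real x + r) \<le> K * (x\<^sup>2 + \<bar>x\<bar> + 1)"
proof -
  have "norm (p * (of_real x)\<^sup>2 + q * of_real x + r)
      \<le> norm (p * (of_real x)\<^sup>2) + norm (q * of_real x) + norm r"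
    by (meson add_mono norm_triangle_ineq order_refl order_trans)
  also have "\<dots> = norm p * x\<^sup>2 + norm q * \<bar>x\<bar> + norm r"
    by (simp add: norm_mult norm_power)
  also have "\<dots> \<le> K * x\<^sup>2 + K * \<bar>x\<bar> + K"
    using assms by (intro add_mono mult_right_mono) auto
  finally show ?thesis by (simp add: algebra_simps)
qed

lemma Re_quadratic_le:
  fixes a b c :: complex and x :: real
  assumes "Re a \<le> - d" "norm b \<le> K" "norm c \<le> K"
  shows "Re (a * (of_real x)\<^sup>2 + b * of_real x + c) \<le> - d * x\<^sup>2 + K * \<bar>x\<bar> + K"
proof -
  have "Re (a * (of_real x)\<^sup>2) = Re a * x\<^sup>2" by (simp flip: of_real_power)
  also have "\<dots> \<le> - d * x\<^sup>2" using assms by (intro mult_right_mono) auto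
  finally have 1: "Re (a * (of_real x)\<^sup>2) \<le> - d * x\<^sup>2" .
  have "Re (b * of_real x) \<le> norm (b * of_real x)" by (rule complex_Re_le_cmod)
  also have "\<dots> \<le> K * \<bar>x\<bar>" using assms by (auto simp: norm_mult intro: mult_right_mono)
  finally have 2: "Re (b * of_real x) \<le> K * \<bar>x\<bar>" .
  have "Re c \<le> K" using complex_Re_le_cmod[of c] assms by simp
  then show ?thesis using 1 2 by simp
qed

text \<open>Mean value inequality on the half-plane \<open>Re \<zeta> \<le> R\<close>, which is
  convex and on which the derivative of \<open>exp\<close> has norm at most
  \<open>exp R\<close>.\<close>

lemma norm_exp_diff_le:
  fixes w z :: complex
  assumes "Re w \<le> R" "Re z \<le> R"
  shows "norm (exp w - exp z) \<le> exp R * norm (w - z)"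
proof (rule field_differentiable_bound[where S = "{\<zeta>. Re \<zeta> \<le> R}" and f' = exp])
  show "convex {\<zeta>. Re \<zeta> \<le> R}" by (rule convex_halfspace_Re_le)
qed (use assms in \<open>auto intro!: derivative_eq_intros\<close>)

text \<open>The polynomial factor is included so that both the wave function and its time derivative
  are covered.\<close>

lemma quadratic_times_gaussian_L2:
  fixes a b c p q r :: complex
  assumes "Re a < 0"
  shows "(\<lambda>x. (p * (of_real x)\<^sup>2 + q * of_real x + r) * exp (a * (of_real x)\<^sup>2 + b * of_real x + c)) \<in> L2"
proof -
  let ?f = "\<lambda>x. (p * (of_real x)\<^sup>2 + q * of_real x + r) * exp (a * (of_real x)\<^sup>2 + b * of_real x + c)"
  define d where "d = - Re a"
  define K where "K = norm b + norm c + norm p + norm q + norm r"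
  define C where "C = 2 * K * exp (K + (K + 1)\<^sup>2 / (2 * d))"
  have d: "d > 0" using assms by (simp add: d_def)
  have K: "norm b \<le> K" "norm c \<le> K" "norm p \<le> K" "norm q \<le> K" "norm r \<le> K" "K \<ge> 0"
    by (simp_all add: K_def)
  have "continuous_on UNIV ?f" by (intro continuous_intros)
  then have meas: "?f \<in> borel_measurable borel" by (rule borel_measurable_continuous_onI)
  have le: "norm (?f x) \<le> C * exp (- (d / 2) * x\<^sup>2)" for x
  proof -
    have "norm (?f x) \<le> K * (x\<^sup>2 + \<bar>x\<bar> + 1) * exp (- d * x\<^sup>2 + K * \<bar>x\<bar> + K)"
      unfolding norm_mult norm_exp_eq_Re
      using K by (intro mult_mono norm_quadratic_le iffD2[OF exp_le_cancel_iff] Re_quadratic_le)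
        (auto simp: d_def)
    also have "\<dots> \<le> C * exp (- (d / 2) * x\<^sup>2)"
      unfolding C_def using d K by (intro quadratic_times_exp_le)
    finally show ?thesis .
  qed
  have "(cmod (?f x))\<^sup>2 \<le> C\<^sup>2 * exp (- d * x\<^sup>2)" for x
  proof -
    have "(cmod (?f x))\<^sup>2 \<le> (C * exp (- (d / 2) * x\<^sup>2))\<^sup>2" by (intro power_mono le) simp
    also have "\<dots> = C\<^sup>2 * exp (- d * x\<^sup>2)"
      by (simp add: power_mult_distrib flip: exp_double)
    finally show ?thesis .
  qed
  then have "integrable lborel (\<lambda>x. (cmod (?f x))\<^sup>2)"
    using meas by (intro Bochner_Integration.integrable_bound[OF
        integrable_mult_right[OF integrable_exp_minus_square[OF d], of "C\<^sup>2"]]) auto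
  then show ?thesis using meas by (simp add: L2_def)
qed

section \<open>Time derivatives of Gaussians, pointwise and in the mean\<close>

lemma has_vector_derivative_iff_quotient_tendsto:
  fixes f :: "real \<Rightarrow> complex"
  shows "(f has_vector_derivative D) (at t within I) \<longleftrightarrow>
    ((\<lambda>s. (f s - f t) / of_real (s - t)) \<longlongrightarrow> D) (at t within I)"
proof -
  have "((\<lambda>s. (f s - f t) / of_real (s - t)) \<longlongrightarrow> D) (at t within I) \<longleftrightarrow>
    ((\<lambda>s. norm ((f s - f t) / of_real (s - t) - D)) \<longlongrightarrow> 0) (at t within I)"
    by (simp add: tendsto_norm_zero_iff flip: LIM_zero_iff[of f] Lim_null)
  also have "\<dots> \<longleftrightarrow> ((\<lambda>s. norm (f s - f t - (s - t) *\<^sub>R D) / norm (s - t)) \<longlongrightarrow> 0) (at t within I)"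
  \<comment> \<open>At \<open>s = t\<close> the values are \<open>norm D\<close> and, since
    \<open>x / 0 = 0\<close>, zero; the filter ignores this point.\<close>
  proof (rule tendsto_cong, unfold eventually_at_filter, rule always_eventually, intro allI impI)
    fix s assume "s \<noteq> t"
    then have "(f s - f t) / of_real (s - t) - D = (f s - f t - (s - t) *\<^sub>R D) / of_real (s - t)"
      by (simp add: field_simps scaleR_conv_of_real)
    then show "norm ((f s - f t) / of_real (s - t) - D) = norm (f s - f t - (s - t) *\<^sub>R D) / norm (s - t)"
      by (simp add: norm_divide flip: of_real_diff)
  qed
  finally show ?thesis
    by (simp add: has_vector_derivative_def has_derivative_iff_norm bounded_linear_scaleR_left)
qed

lemma exp_quadratic_has_vector_derivative:
  fixes a b c :: "real \<Rightarrow> complex" and x :: real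
  assumes "(a has_vector_derivative a') (at t within I)"
    and "(b has_vector_derivative b') (at t within I)"
    and "(c has_vector_derivative c') (at t within I)"
  shows "((\<lambda>s. exp (a s * (of_real x)\<^sup>2 + b s * of_real x + c s)) has_vector_derivative
    (a' * (of_real x)\<^sup>2 + b' * of_real x + c') * exp (a t * (of_real x)\<^sup>2 + b t * of_real x + c t))
    (at t within I)"
proof -
  have "((\<lambda>s. a s * (of_real x)\<^sup>2 + b s * of_real x + c s) has_vector_derivative
      a' * (of_real x)\<^sup>2 + b' * of_real x + c') (at t within I)"
    by (intro derivative_intros assms)
  from field_vector_diff_chain_within[OF this DERIV_exp[THEN DERIV_subset[OF _ subset_UNIV]]]
  show ?thesis by (simp add: o_def)
qed

lemma exp_quadratic_has_L2_derivative:
  fixes a b c :: "real \<Rightarrow> complex"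
  assumes a: "(a has_vector_derivative a') (at t within I)"
    and b: "(b has_vector_derivative b') (at t within I)"
    and c: "(c has_vector_derivative c') (at t within I)"
    and neg: "Re (a t) < 0"
  shows "has_L2_derivative (\<lambda>s x. exp (a s * (of_real x)\<^sup>2 + b s * of_real x + c s))
    (\<lambda>x. (a' * (of_real x)\<^sup>2 + b' * of_real x + c') * exp (a t * (of_real x)\<^sup>2 + b t * of_real x + c t))
    t I"
proof -
  define w where "w = (\<lambda>s x. a s * (complex_of_real x)\<^sup>2 + b s * of_real x + c s)"
  define D where "D = (\<lambda>x::real. (a' * (of_real x)\<^sup>2 + b' * of_real x + c') * exp (w t x))"
  define q where "q = (\<lambda>s x. (exp (w s x) - exp (w t x)) / of_real (s - t))"
  \<comment> \<open>Halving leaves room for \<open>Re (a s)\<close> to stay below \<open>- d\<close>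
    for \<open>s\<close> near \<open>t\<close>.\<close>
  define d where "d = - Re (a t) / 2"
  \<comment> \<open>The summand 1 makes the bounds at \<open>t\<close> strict, so they persist for
    \<open>s\<close> near \<open>t\<close>; the norms of the derivatives control the difference
    quotients of the coefficients.\<close>
  define K where "K = 1 + norm (b t) + norm (c t) + norm a' + norm b' + norm c'"
  define C where "C = 2 * K * exp (K + (K + 1)\<^sup>2 / (2 * d))"
  have d: "d > 0" using neg by (simp add: d_def)
  have K: "norm (b t) < K" "norm (c t) < K" "norm a' < K" "norm b' < K" "norm c' < K" "K \<ge> 0"
    unfolding K_def by (smt (verit) norm_ge_zero)+
  have D_L2: "D \<in> L2" unfolding D_def w_def by (rule quadratic_times_gaussian_L2[OF neg])
  have meas: "(\<lambda>x. q s x - D x) \<in> borel_measurable borel" for s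
  proof (rule borel_measurable_continuous_onI)
    show "continuous_on UNIV (\<lambda>x. q s x - D x)"
      unfolding q_def D_def w_def divide_inverse by (intro continuous_intros)
  qed
  have pointwise: "((\<lambda>s. q s x) \<longlongrightarrow> D x) (at t within I)" for x
    using exp_quadratic_has_vector_derivative[OF a b c, of x]
    by (simp add: has_vector_derivative_iff_quotient_tendsto q_def D_def w_def)
  have tail: "\<forall>\<^sub>F s in at t within I. Re (a s) \<le> - d \<and> norm (b s) \<le> K \<and> norm (c s) \<le> K \<and>
    norm ((a s - a t) / of_real (s - t)) \<le> K \<and> norm ((b s - b t) / of_real (s - t)) \<le> K \<and>
    norm ((c s - c t) / of_real (s - t)) \<le> K \<and> s \<noteq> t"
  proof -
    note cont = has_vector_derivative_continuous[unfolded continuous_within]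
    note quotient = has_vector_derivative_iff_quotient_tendsto[THEN iffD1]
    have "\<forall>\<^sub>F s in at t within I. Re (a s) < - d"
      using neg by (intro order_tendstoD(2)[OF tendsto_Re[OF cont[OF a]]]) (simp add: d_def)
    moreover have "\<forall>\<^sub>F s in at t within I. norm (b s) < K" "\<forall>\<^sub>F s in at t within I. norm (c s) < K"
      by (rule order_tendstoD(2)[OF tendsto_norm[OF cont[OF b]] K(1)]
          order_tendstoD(2)[OF tendsto_norm[OF cont[OF c]] K(2)])+
    moreover have "\<forall>\<^sub>F s in at t within I. norm ((a s - a t) / of_real (s - t)) < K"
      "\<forall>\<^sub>F s in at t within I. norm ((b s - b t) / of_real (s - t)) < K"
      "\<forall>\<^sub>F s in at t within I. norm ((c s - c t) / of_real (s - t)) < K"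
      by (rule order_tendstoD(2)[OF tendsto_norm[OF quotient[OF a]] K(3)]
          order_tendstoD(2)[OF tendsto_norm[OF quotient[OF b]] K(4)]
          order_tendstoD(2)[OF tendsto_norm[OF quotient[OF c]] K(5)])+
    moreover have "\<forall>\<^sub>F s in at t within I. s \<noteq> t" by (simp add: eventually_at_filter)
    ultimately show ?thesis by eventually_elim auto
  qed
  have bound: "\<forall>\<^sub>F s in at t within I. \<forall>x. norm (q s x) \<le> C * exp (- (d / 2) * x\<^sup>2)"
    using tail
  proof eventually_elim
    case (elim s)
    show ?case
    proof
      fix x :: real
      define R where "R = - d * x\<^sup>2 + K * \<bar>x\<bar> + K"
      have "Re (w s x) \<le> R" unfolding w_def R_def using elim by (intro Re_quadratic_le) auto
      moreover have "Re (w t x) \<le> R"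
        unfolding w_def R_def using K neg by (intro Re_quadratic_le) (auto simp: d_def)
      ultimately have "norm (exp (w s x) - exp (w t x)) \<le> exp R * norm (w s x - w t x)"
        by (rule norm_exp_diff_le)
      then have "norm (q s x) \<le> exp R * norm ((w s x - w t x) / of_real (s - t))"
        by (simp add: q_def norm_divide divide_right_mono)
      also have "(w s x - w t x) / of_real (s - t) =
        (a s - a t) / of_real (s - t) * (of_real x)\<^sup>2 + (b s - b t) / of_real (s - t) * of_real x
          + (c s - c t) / of_real (s - t)"
        by (simp add: w_def diff_divide_distrib add_divide_distrib algebra_simps)
      also have "exp R * norm \<dots> \<le> exp R * (K * (x\<^sup>2 + \<bar>x\<bar> + 1))"
        using elim by (intro mult_left_mono norm_quadratic_le) auto
      also have "\<dots> = K * (x\<^sup>2 + \<bar>x\<bar> + 1) * exp R" by simp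
      also have "\<dots> \<le> C * exp (- (d / 2) * x\<^sup>2)"
        unfolding C_def R_def using d K by (intro quadratic_times_exp_le)
      finally show "norm (q s x) \<le> C * exp (- (d / 2) * x\<^sup>2)" .
    qed
  qed
  have "((\<lambda>s. L2_norm (\<lambda>x. q s x - D x)) \<longlongrightarrow> 0) (at t within I)"
    \<comment> \<open>Dominated convergence is applied along sequences, so the limit is tested on
      them.\<close>
    unfolding tendsto_at_iff_sequentially
  proof (intro allI impI)
    fix X assume XI: "\<forall>i. X i \<in> I - {t}" and X: "X \<longlonglongrightarrow> t"
    have XF: "filterlim X (at t within I) sequentially"
      using X XI by (auto simp: filterlim_at)
    \<comment> \<open>The majorant holds only from some index \<open>N\<close> on; the sequence is
      shifted by \<open>N\<close>, and \<open>LIMSEQ_offset\<close> undoes the shift at the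
      end.\<close>
    obtain N where N: "norm (q (X i) x) \<le> C * exp (- (d / 2) * x\<^sup>2)" if "i \<ge> N" for i x
      using eventually_compose_filterlim[OF bound XF] by (auto simp: eventually_sequentially)
    have qD: "(\<lambda>i. q (X i) x) \<longlonglongrightarrow> D x" for x
      by (rule filterlim_compose[OF pointwise XF])
    \<comment> \<open>The pointwise limit inherits the majorant, so the error is dominated by twice
      it; squaring yields the factor 4.\<close>
    have ND: "norm (D x) \<le> C * exp (- (d / 2) * x\<^sup>2)" for x
      by (rule LIMSEQ_le_const2[OF tendsto_norm[OF qD]]) (use N in blast)
    have le: "(cmod (q (X (i + N)) x - D x))\<^sup>2 \<le> 4 * C\<^sup>2 * exp (- d * x\<^sup>2)" for i x
    proof -
      have "norm (q (X (i + N)) x - D x) \<le> 2 * C * exp (- (d / 2) * x\<^sup>2)"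
        using norm_triangle_ineq4[of "q (X (i + N)) x" "D x"] N[of "i + N" x] ND[of x] by simp
      then have "(cmod (q (X (i + N)) x - D x))\<^sup>2 \<le> (2 * C * exp (- (d / 2) * x\<^sup>2))\<^sup>2"
        by (rule power_mono) simp
      also have "\<dots> = 4 * C\<^sup>2 * exp (- d * x\<^sup>2)"
        by (simp add: power_mult_distrib flip: exp_double)
      finally show ?thesis .
    qed
    have "(\<lambda>i. LINT x|lborel. (cmod (q (X (i + N)) x - D x))\<^sup>2) \<longlonglongrightarrow> (LINT x::real|lborel. (0::real))"
    proof (rule integral_dominated_convergence)
      show "integrable lborel (\<lambda>x. 4 * C\<^sup>2 * exp (- d * x\<^sup>2))"
        by (intro integrable_mult_right integrable_exp_minus_square d)
      show "AE x in lborel. (\<lambda>i. (cmod (q (X (i + N)) x - D x))\<^sup>2) \<longlonglongrightarrow> 0"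
      proof (rule AE_I2)
        fix x
        have "(\<lambda>i. (cmod (q (X i) x - D x))\<^sup>2) \<longlonglongrightarrow> (cmod (D x - D x))\<^sup>2"
          by (intro tendsto_intros qD)
        from LIMSEQ_ignore_initial_segment[OF this, of N]
        show "(\<lambda>i. (cmod (q (X (i + N)) x - D x))\<^sup>2) \<longlonglongrightarrow> 0" by simp
      qed
    next
      show "(\<lambda>x. (cmod (q (X (i + N)) x - D x))\<^sup>2) \<in> borel_measurable lborel" for i
        using meas by measurable
      show "AE x in lborel. norm ((cmod (q (X (i + N)) x - D x))\<^sup>2) \<le> 4 * C\<^sup>2 * exp (- d * x\<^sup>2)" for i
        using le by simp
    qed simp
    from tendsto_real_sqrt[OF this]
    have "(\<lambda>i. L2_norm (\<lambda>x. q (X (i + N)) x - D x)) \<longlonglongrightarrow> 0"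
      by (simp add: L2_norm_def)
    then show "((\<lambda>s. L2_norm (\<lambda>x. q s x - D x)) \<circ> X) \<longlonglongrightarrow> 0"
      unfolding o_def by (rule LIMSEQ_offset)
  qed
  then show ?thesis
    using D_L2 by (simp add: has_L2_derivative_def q_def D_def w_def)
qed

section \<open>Smoothness of Gaussians in \<open>x\<close> and the action of \<open>QQ\<close> on
  them\<close>

lemma poly_times_exp_has_vector_derivative:
  fixes a b c :: complex and P :: "complex poly" and x :: real
  shows "((\<lambda>x. poly P (of_real x) * exp (a * (of_real x)\<^sup>2 + b * of_real x + c)) has_vector_derivative
    poly (pderiv P + P * [:b, 2 * a:]) (of_real x) * exp (a * (of_real x)\<^sup>2 + b * of_real x + c)) (at x)"
  by (rule has_vector_derivative_real_field) (auto intro!: derivative_eq_intros simp: algebra_simps)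

lemma Dx_poly_times_exp:
  fixes a b c :: complex and P :: "complex poly"
  shows "Dx (\<lambda>x. poly P (of_real x) * exp (a * (of_real x)\<^sup>2 + b * of_real x + c)) =
    (\<lambda>x. poly (pderiv P + P * [:b, 2 * a:]) (of_real x) * exp (a * (of_real x)\<^sup>2 + b * of_real x + c))"
  unfolding Dx_def by (rule ext vector_derivative_at poly_times_exp_has_vector_derivative)+

text \<open>Polynomial multiples of a fixed Gaussian are closed under \<open>Dx\<close>, so by
  induction every iterated derivative is again such a multiple, hence differentiable.\<close>

lemma exp_quadratic_Cinf:
  fixes a b c :: complex
  shows "(\<lambda>x. exp (a * (of_real x)\<^sup>2 + b * of_real x + c)) \<in> Cinf"
proof -
  define E where "E = (\<lambda>x::real. exp (a * (of_real x)\<^sup>2 + b * of_real x + c))"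
  have derivatives: "\<exists>P. (Dx ^^ n) E = (\<lambda>x. poly P (of_real x) * E x)" for n
  proof (induction n)
    case 0
    have "(Dx ^^ 0) E = (\<lambda>x. poly 1 (of_real x) * E x)" by simp
    then show ?case ..
  next
    case (Suc n)
    then obtain P where P: "(Dx ^^ n) E = (\<lambda>x. poly P (of_real x) * E x)" by blast
    have "(Dx ^^ Suc n) E = (\<lambda>x. poly (pderiv P + P * [:b, 2 * a:]) (of_real x) * E x)"
      unfolding funpow.simps o_apply P unfolding E_def by (rule Dx_poly_times_exp)
    then show ?case by blast
  qed
  have "(\<lambda>x. poly P (of_real x) * E x) differentiable (at x)" for P x
    unfolding E_def by (rule differentiableI_vector[OF poly_times_exp_has_vector_derivative])
  then have "(Dx ^^ n) E differentiable (at x)" for n x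
    using derivatives[of n] by auto
  then show ?thesis by (simp add: Cinf_def E_def)
qed

text \<open>Differentiating the Gaussian once multiplies it by \<open>2 * a * x + b\<close>, twice
  by the square of this plus \<open>2 * a\<close>; hence each basis operator acts on it as
  multiplication by a polynomial of degree at most two.\<close>

lemma QQ_exp_quadratic:
  fixes a b c :: complex and x :: real
  shows "QQ L (\<lambda>x. exp (a * (of_real x)\<^sup>2 + b * of_real x + c)) x =
    gJ_extend (- (of_real x)\<^sup>2) (- (2 * a * of_real x + b)\<^sup>2 - 2 * a)
      (2 * \<i> * (of_real x * (2 * a * of_real x + b) + 1/2)) (- \<i> * (2 * a * of_real x + b))
      (of_real x) (- 1/4) L * exp (a * (of_real x)\<^sup>2 + b * of_real x + c)"
proof -
  define E where "E = (\<lambda>x::real. exp (a * (of_real x)\<^sup>2 + b * of_real x + c))"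
  have Ex: "exp (a * (of_real x)\<^sup>2 + b * of_real x + c) = E x" by (simp add: E_def)
  have D1: "Dx E = (\<lambda>x. poly [:b, 2 * a:] (of_real x) * E x)"
    using Dx_poly_times_exp[of 1 a b c] by (simp add: E_def)
  have D2: "Dx (Dx E) x = ((2 * a * of_real x + b)\<^sup>2 + 2 * a) * E x"
    unfolding D1 using Dx_poly_times_exp[of "[:b, 2 * a:]" a b c]
    by (simp add: E_def pderiv_pCons algebra_simps power2_eq_square)
  show ?thesis
    \<comment> \<open>\<open>D2\<close> is applied before \<open>D1\<close>, which would otherwise
      rewrite the inner derivative in \<open>Dx (Dx E)\<close>.\<close>
    unfolding E_def[symmetric] Ex QQ_def D2
    unfolding D1 gJ_extend_mult_right
    by (rule gJ_extend_cong) (simp_all add: algebra_simps)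
qed

section \<open>The Schroedinger equation\<close>

lemma log_partition_has_derivative:
  assumes "p \<in> SJ"
  shows "(log_partition has_derivative (\<lambda>Y. Im (snd p) * Im (snd Y) / (2 * Im (fst p))
    - (Im (snd p))\<^sup>2 * Im (fst Y) / (4 * (Im (fst p))\<^sup>2) - Im (fst Y) / (2 * Im (fst p)))) (at p)"
proof -
  have "Im (fst p) > 0" using assms by (auto simp: SJ_def)
  then show ?thesis
    unfolding log_partition_def[abs_def] theta1_def theta2_def
    by (auto intro!: derivative_eq_intros simp: field_simps power2_eq_square)
qed

text \<open>The relations \<open>e1\<close> and \<open>e2\<close> cancel all imaginary terms, so
  \<open>kappa\<close> is real, and they make its \<open>H\<close> component vanish.\<close>

lemma kappa_eq:
  assumes "p \<in> SJ"
  shows "kappa p L = of_real (gJ_extend 0 (((Im (snd p))\<^sup>2 - (Re (snd p))\<^sup>2) / 4 - Im (fst p)) 0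
    (Re (snd p) / 2) 0 (1/4) L)"
proof -
  obtain A a b c where L: "L = (A, (a, b, c))" by (metis surj_pair)
  have v: "Im (fst p) \<noteq> 0" using assms by (auto simp: SJ_def)
  have e1: "eta1 p * theta2 p = - theta1 p / 2"
    and e2: "2 * eta2 p * theta2 p = - eta1 p * theta1 p - 1"
    using v by (simp_all add: eta1_def eta2_def theta1_def theta2_def field_simps power2_eq_square)
  define t1 t2 d1 d2 f1 f2 where "t1 = complex_of_real (theta1 p)"
    and "t2 = complex_of_real (theta2 p)" and "d1 = complex_of_real (dtheta1 p)"
    and "d2 = complex_of_real (dtheta2 p)" and "f1 = complex_of_real (eta1 p)"
    and "f2 = complex_of_real (eta2 p)"
  have f1: "f1 * t2 = - t1 / 2" and f2: "2 * f2 * t2 = - f1 * t1 - 1"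
    using e1[THEN arg_cong[where f = complex_of_real]] e2[THEN arg_cong[where f = complex_of_real]]
    by (simp_all add: t1_def t2_def f1_def f2_def)
  have G: "\<i> * f1 * (d1 * t2 + t1 * d2) + 2 * \<i> * f2 * t2 * d2 - 1/4 * d1\<^sup>2 + t2 + \<i> * d2
      + 1/4 * t1\<^sup>2 + \<i> / 2 * t1 * d1 = (t1\<^sup>2 - d1\<^sup>2) / 4 + t2"
    using f1 f2 by (simp add: field_simps) algebra
  have H: "- \<i> * (f1 * t1 + 2 * f2 * t2 + 1) = 0" using f2 by simp
  have P: "\<i> * ((t1 + \<i> * d1) / 2 + t2 * f1) = - d1 / 2"
    using f1 by (simp add: field_simps)
  show ?thesis
    unfolding kappa_def Let_def t1_def[symmetric] t2_def[symmetric] d1_def[symmetric]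
      d2_def[symmetric] f1_def[symmetric] f2_def[symmetric] G H P
    by (simp add: gJ_extend_def L t1_def t2_def d1_def theta1_def theta2_def dtheta1_def
        scaleR_conv_of_real)
qed

text \<open>The left side is the derivative of \<open>log_partition\<close> in the direction
  \<open>Y\<close>; along this field all negative powers of \<open>Im (fst p)\<close>
  cancel.\<close>

lemma log_partition_derivative_along_jacobi_field:
  assumes "p \<in> SJ" and Y: "Y = jacobi_field L p"
  shows "Im (snd p) * Im (snd Y) / (2 * Im (fst p))
      - (Im (snd p))\<^sup>2 * Im (fst Y) / (4 * (Im (fst p))\<^sup>2) - Im (fst Y) / (2 * Im (fst p))
    = gJ_extend 0 (Re (fst p) - Re (snd p) * Im (snd p) / 2) (- 1) (Im (snd p) / 2) 0 0 L"
proof -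
  obtain A a b c where L: "L = (A, (a, b, c))" by (metis surj_pair)
  have v: "Im (fst p) \<noteq> 0" using assms by (auto simp: SJ_def)
  then show ?thesis
    unfolding Y jacobi_field_def L gJ_extend_def
    by (simp add: Im_power2 field_simps power2_eq_square)
qed

text \<open>Neither term is holomorphic alone, but the real one from the normalization and the
  imaginary one from the phase assemble into a holomorphic polynomial in \<tau> and
  \<open>z\<close>. It is the time derivative of the constant term of the exponent.\<close>

lemma kappa_minus_log_partition_derivative:
  assumes "p \<in> SJ" and Y: "Y = jacobi_field L p"
  shows "\<i> / 2 * kappa p L - of_real (Im (snd p) * Im (snd Y) / (2 * Im (fst p))
      - (Im (snd p))\<^sup>2 * Im (fst Y) / (4 * (Im (fst p))\<^sup>2) - Im (fst Y) / (2 * Im (fst p))) / 2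
    = gJ_extend 0 (- \<i> * ((snd p)\<^sup>2 / 4 - \<i> * fst p) / 2) (1/2) (\<i> * snd p / 4) 0 (\<i> / 8) L"
  unfolding kappa_eq[OF assms(1)] log_partition_derivative_along_jacobi_field[OF assms]
    gJ_extend_arith
  by (rule gJ_extend_cong) (simp_all add: complex_eq_iff Re_power2 Im_power2 field_simps)

lemma exp_times_Psi:
  "exp (\<i> / 2 * f) * Psi p x = exp (\<i> * fst p / 2 * (of_real x)\<^sup>2 + - \<i> * snd p / 2 * of_real x
    + (\<i> / 2 * f - of_real (log_partition p) / 2))"
proof -
  have "z1 p = - \<i> * snd p" "z2 p = \<i> * fst p"
    by (simp_all add: z1_def z2_def theta1_def theta2_def dtheta1_def dtheta2_def complex_eq_iff)
  then show ?thesis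
    by (simp add: Psi_def algebra_simps add_divide_distrib diff_divide_distrib flip: exp_add)
qed

theorem corollary4p9:
  fixes L :: jacobi and I :: "real set" and \<alpha> :: "real \<Rightarrow> complex \<times> complex"
    and F :: "real \<Rightarrow> complex"
  assumes "L \<in> gJ"
    and "is_interval I"
    and "integral_curve_on I SJ (hamiltonian_vf (JJ L)) \<alpha>"
    and "\<And>t. t \<in> I \<Longrightarrow> (F has_vector_derivative kappa (\<alpha> t) L) (at t within I)"
  shows "schroedinger_solution I
    (\<lambda>\<phi> x. 1/2 * QQ L \<phi> x)
    (\<lambda>t x. exp (\<i> / 2 * F t) * Psi (\<alpha> t) x)"
proof -
  define a where "a = (\<lambda>t. \<i> * fst (\<alpha> t) / 2)"
  define b where "b = (\<lambda>t. - \<i> * snd (\<alpha> t) / 2)"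
  define c where "c = (\<lambda>t. \<i> / 2 * F t - of_real (log_partition (\<alpha> t)) / 2)"
  have wave: "(\<lambda>t x. exp (\<i> / 2 * F t) * Psi (\<alpha> t) x) =
      (\<lambda>t x. exp (a t * (of_real x)\<^sup>2 + b t * of_real x + c t))"
    unfolding exp_times_Psi a_def b_def c_def ..
  show ?thesis
    unfolding schroedinger_solution_def wave
  proof (intro ballI conjI exp_quadratic_Cinf)
    fix t assume t: "t \<in> I"
    define Y where "Y = jacobi_field L (\<alpha> t)"
    define c' where "c' = gJ_extend 0 (- \<i> * ((snd (\<alpha> t))\<^sup>2 / 4 - \<i> * fst (\<alpha> t)) / 2) (1/2)
      (\<i> * snd (\<alpha> t) / 4) 0 (\<i> / 8) L"
    have SJ: "\<alpha> t \<in> SJ" and \<alpha>: "(\<alpha> has_vector_derivative Y) (at t within I)"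
      using assms(3) t by (auto simp: integral_curve_on_def hamiltonian_vf_JJ Y_def)
    have neg: "Re (a t) < 0" using SJ by (auto simp: SJ_def a_def)
    have fst: "((\<lambda>s. fst (\<alpha> s)) has_vector_derivative fst Y) (at t within I)"
      and snd: "((\<lambda>s. snd (\<alpha> s)) has_vector_derivative snd Y) (at t within I)"
      using \<alpha> by (auto simp: has_vector_derivative_def intro!: derivative_eq_intros)
    have a: "(a has_vector_derivative \<i> * fst Y / 2) (at t within I)"
      and b: "(b has_vector_derivative - \<i> * snd Y / 2) (at t within I)"
      unfolding a_def b_def by (auto intro!: derivative_eq_intros fst snd)
    have c: "(c has_vector_derivative c') (at t within I)"
    proof -
      \<comment> \<open>Chain rule along the curve, whose velocity at \<open>t\<close> is
        \<open>Y\<close>.\<close>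
      have lp: "((\<lambda>s. log_partition (\<alpha> s)) has_real_derivative
          Im (snd (\<alpha> t)) * Im (snd Y) / (2 * Im (fst (\<alpha> t)))
          - (Im (snd (\<alpha> t)))\<^sup>2 * Im (fst Y) / (4 * (Im (fst (\<alpha> t)))\<^sup>2)
          - Im (fst Y) / (2 * Im (fst (\<alpha> t)))) (at t within I)"
        using vector_derivative_diff_chain_within[OF \<alpha>
            has_derivative_at_withinI[OF log_partition_has_derivative[OF SJ]]]
        by (simp add: o_def has_real_derivative_iff_has_vector_derivative)
      show ?thesis
        unfolding c_def c'_def kappa_minus_log_partition_derivative[OF SJ Y_def, symmetric]
        by (intro derivative_intros lp assms(4) t)
    qed
    have schroedinger: "\<i> * ((\<i> * fst Y / 2 * (of_real x)\<^sup>2 + - \<i> * snd Y / 2 * of_real x + c')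
        * exp (a t * (of_real x)\<^sup>2 + b t * of_real x + c t))
      = 1/2 * QQ L (\<lambda>x. exp (a t * (of_real x)\<^sup>2 + b t * of_real x + c t)) x" for x
    proof -
      \<comment> \<open>With the common Gaussian factor removed, two polynomials in \<open>x\<close>
        remain, compared separately for each basis element.\<close>
      have "\<i> * (\<i> * fst Y / 2 * (of_real x)\<^sup>2 + - \<i> * snd Y / 2 * of_real x + c') =
        1/2 * gJ_extend (- (of_real x)\<^sup>2) (- (2 * a t * of_real x + b t)\<^sup>2 - 2 * a t)
        (2 * \<i> * (of_real x * (2 * a t * of_real x + b t) + 1/2)) (- \<i> * (2 * a t * of_real x + b t))
        (of_real x) (- 1/4) L"
        unfolding Y_def jacobi_field_components c'_def gJ_extend_arith a_def b_def
        by (rule gJ_extend_cong) (simp_all add: field_simps power2_eq_square)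
      then show ?thesis unfolding QQ_exp_quadratic by (simp add: mult.assoc)
    qed
    show "(\<lambda>x. exp (a t * (of_real x)\<^sup>2 + b t * of_real x + c t)) \<in> L2"
      using quadratic_times_gaussian_L2[OF neg, of 0 0 1 "b t" "c t"] by simp
    show "\<exists>D. has_L2_derivative (\<lambda>t x. exp (a t * (of_real x)\<^sup>2 + b t * of_real x + c t)) D t I \<and>
        (\<forall>x. ((\<lambda>s. exp (a s * (of_real x)\<^sup>2 + b s * of_real x + c s)) has_vector_derivative D x)
          (at t within I)) \<and>
        (\<forall>x. \<i> * D x = 1/2 * QQ L (\<lambda>x. exp (a t * (of_real x)\<^sup>2 + b t * of_real x + c t)) x)"
      by (intro exI[of _ "\<lambda>x. (\<i> * fst Y / 2 * (of_real x)\<^sup>2 + - \<i> * snd Y / 2 * of_real x + c')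
          * exp (a t * (of_real x)\<^sup>2 + b t * of_real x + c t)"] conjI allI
        exp_quadratic_has_L2_derivative[OF a b c neg]
        exp_quadratic_has_vector_derivative[OF a b c] schroedinger)
  qed
qed

end
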